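(* Let $a,b,c,d$ be integers and let $L$ be a rank $2$ subgroup of $(\mathbb{Z}\times\mathbb{Z},+)$ generated by the vectors $(a,b)$ and $(c,d)$. Then $L$ is an ideal of the ring $\mathbb{Z}\times\mathbb{Z}$ if and only if $ad-bc$ divides $\gcd(a,c)\cdot\gcd(b,d)$.
   Context: $\mathbb{Z}\times\mathbb{Z}$ is the product ring with componentwise operations. A subgroup of a ring means a subgroup of its additive group. The rank of a subgroup is its rank as a free $\mathbb{Z}$-module. *)

theory Defs
  imports "HOL-Algebra.Algebra" "HOL-Algebra.Chinese_Remainder" "HOL-Algebra.Free_Abelian_Groups"
begin

abbreviation ZxZ :: "(int \<times> int) ring"
  where "ZxZ \<equiv> RDirProd \<Z> \<Z>"

text \<open>
  A group has free rank \<open>n\<close> if it is free as a \<open>\<int>\<close>-module on a basis of \<open>n\<close> elements. The index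
  set \<open>{..<n}\<close> is an arbitrary choice of \<open>n\<close>-element set; \<open>n\<close> is unique by \<open>has_free_rank_unique\<close>.
\<close>
definition has_free_rank :: "('a, 'b) monoid_scheme \<Rightarrow> nat \<Rightarrow> bool"
  where "has_free_rank G n \<longleftrightarrow> G \<cong> free_Abelian_group {..<n}"

lemma has_free_rank_unique:
  assumes "group G" and "has_free_rank G m" and "has_free_rank G n"
  shows "m = n"
proof -
  have "free_Abelian_group {..<m} \<cong> free_Abelian_group {..<n}"
    using assms unfolding has_free_rank_def by (meson group.iso_sym iso_trans)
  then have "{..<m} \<approx> {..<n}"
    by (simp add: isomorphic_free_Abelian_groups)
  then show ?thesis
    by (simp add: eqpoll_iff_card)
qed

end

theory Submission
  imports Defs
begin

text \<open>
  Write \<open>D = a * d - b * c\<close>. An additive subgroup of \<open>\<int> \<times> \<int>\<close> is an ideal as soon as it is closed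
  under the idempotent \<open>(1, 0)\<close>: the complementary idempotent \<open>(0, 1)\<close> is \<open>1 - (1, 0)\<close>, and every
  ring element is an integer combination of the two (\<open>ideal_ZxZ_iff\<close>). For \<open>L\<close> this closure only
  has to be tested on the generators, so \<open>L\<close> is an ideal iff \<open>(a, 0)\<close> and \<open>(c, 0)\<close> are integer combinations of
  \<open>(a, b)\<close> and \<open>(c, d)\<close>. When \<open>D \<noteq> 0\<close>, Cramer's rule gives the only candidates for the coefficients,
  namely \<open>a * d / D\<close>, \<open>- a * b / D\<close> and \<open>c * d / D\<close>, \<open>- c * b / D\<close>
  (\<open>axis_vector_in_lattice_iff\<close>). Hence \<open>L\<close> is an ideal iff \<open>D\<close>
  divides the four products \<open>a * b\<close>, \<open>a * d\<close>, \<open>c * b\<close>, \<open>c * d\<close>, that is, iff it divides their greatest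
  common divisor, which is \<open>gcd a c * gcd b d\<close> (\<open>dvd_gcd_mult_gcd_iff\<close>).

  The rank hypothesis enters through \<open>D \<noteq> 0\<close>: a group of free rank two contains two independent
  elements, whereas for \<open>D = 0\<close> any two elements of \<open>L\<close> are proportional
  (\<open>free_rank_2_imp_det_nonzero\<close>).
\<close>

section \<open>Divisibility of a product of greatest common divisors\<close>

text \<open>Distributivity expands the product into the gcd of the four products.\<close>

lemma dvd_gcd_mult_gcd_iff:
  fixes k a b c d :: "'a :: semiring_gcd"
  shows "k dvd gcd a c * gcd b d \<longleftrightarrow>
    k dvd a * b \<and> k dvd a * d \<and> k dvd c * b \<and> k dvd c * d"
proof -
  have dvd_mult_gcd: "k dvd x * gcd y z \<longleftrightarrow> k dvd x * y \<and> k dvd x * z" for x y z :: 'a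
    by (metis dvd_normalize_iff gcd_greatest_iff gcd_mult_left)
  show ?thesis
    by (metis dvd_mult_gcd mult.commute)
qed

section \<open>The additive group of the product ring\<close>

lemma ring_ZxZ: "ring ZxZ"
  by (intro RDirProd_ring int.ring_axioms)

lemma group_add_ZxZ: "group (add_monoid ZxZ)"
  by (rule abelian_group.a_group[OF ring.is_abelian_group[OF ring_ZxZ]])

text \<open>
  The additive group is kept in the form \<open>add_monoid ZxZ\<close>, in which the hypotheses about \<open>L\<close> are
  phrased; the rule removed here would turn it into a direct product of groups.
\<close>

declare RDirProd_add_monoid [simp del]

lemma ZxZ_simps [simp]:
  "carrier ZxZ = UNIV"
  "\<zero>\<^bsub>ZxZ\<^esub> = (0, 0)"
  "(x, y) \<oplus>\<^bsub>ZxZ\<^esub> (z, w) = (x + z, y + w)"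
  "(x, y) \<otimes>\<^bsub>ZxZ\<^esub> (z, w) = (x * z, y * w)"
  by (simp_all add: RDirProd_def DirProd_def monoid.defs)

lemma inv_add_ZxZ: "inv\<^bsub>add_monoid ZxZ\<^esub> (x, y) = (- x, - y)"
  by (rule group.inv_equality[OF group_add_ZxZ]) simp_all

lemma int_pow_add_ZxZ:
  fixes k :: int
  shows "(x, y) [^]\<^bsub>add_monoid ZxZ\<^esub> k = (k * x, k * y)"
proof -
  have nat_pow: "(x, y) [^]\<^bsub>add_monoid ZxZ\<^esub> n = (int n * x, int n * y)" for n :: nat
    by (induction n) (simp_all add: nat_pow_def algebra_simps)
  show ?thesis
    unfolding int_pow_def2 nat_pow inv_add_ZxZ by simp
qed

section \<open>Independent elements in a group of free rank two\<close>

text \<open>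
  The independent elements are the preimages of the two basis vectors under an isomorphism onto the
  free abelian group.
\<close>

lemma free_rank_2_independent_pair:
  assumes "group G" and "has_free_rank G 2"
  obtains u v where "u \<in> carrier G" and "v \<in> carrier G"
    and "\<And>(m::int) (n::int). u [^]\<^bsub>G\<^esub> m = v [^]\<^bsub>G\<^esub> n \<Longrightarrow> m = 0 \<and> n = 0"
proof -
  interpret group G by fact
  let ?F = "free_Abelian_group {..<2::nat}"
  obtain h where h: "h \<in> iso G ?F"
    using assms(2) unfolding has_free_rank_def is_iso_def by blast
  then have hom: "h \<in> hom G ?F" and surj: "h ` carrier G = carrier ?F"
    by (auto simp: iso_def bij_betw_def)
  have "frag_of 0 \<in> h ` carrier G" "frag_of 1 \<in> h ` carrier G"
    by (simp_all add: surj)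
  then obtain u v where u: "u \<in> carrier G" "h u = frag_of 0" and v: "v \<in> carrier G" "h v = frag_of 1"
    by (metis imageE)
  have "m = 0 \<and> n = 0" if "u [^]\<^bsub>G\<^esub> m = v [^]\<^bsub>G\<^esub> n" for m n :: int
  proof -
    interpret hom: group_hom G ?F h
      using hom by (simp add: group_hom_def group_hom_axioms_def)
    have "frag_cmul m (frag_of (0::nat)) = frag_cmul n (frag_of 1)"
      using arg_cong[OF that, of h] u v by (simp add: hom.hom_int_pow)
    then have "Poly_Mapping.lookup (frag_cmul m (frag_of (0::nat))) i
        = Poly_Mapping.lookup (frag_cmul n (frag_of 1)) i" for i
      by (rule arg_cong)
    from this[of 0] this[of 1] show ?thesis
      by simp
  qed
  with u v that show thesis by blast
qed

section \<open>The subgroup generated by two vectors\<close>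

lemma generate_pair_ZxZ:
  "generate (add_monoid ZxZ) {(a, b), (c, d)} = {(m * a + n * c, m * b + n * d) | m n. True}"
    (is "generate ?G ?S = ?R")
proof
  interpret group ?G by (rule group_add_ZxZ)
  have "subgroup ?R ?G"
  proof (rule subgroupI)
    show "inv\<^bsub>?G\<^esub> p \<in> ?R" if p: "p \<in> ?R" for p
    proof -
      obtain m n where "p = (m * a + n * c, m * b + n * d)"
        using p by blast
      then have "inv\<^bsub>?G\<^esub> p = (- m * a + - n * c, - m * b + - n * d)"
        by (simp only: inv_add_ZxZ) simp
      then show ?thesis by blast
    qed
    show "p \<otimes>\<^bsub>?G\<^esub> q \<in> ?R" if pq: "p \<in> ?R" "q \<in> ?R" for p q
    proof -
      obtain m n m' n' where "p = (m * a + n * c, m * b + n * d)"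
        and "q = (m' * a + n' * c, m' * b + n' * d)"
        using pq by blast
      then have "p \<otimes>\<^bsub>?G\<^esub> q = ((m + m') * a + (n + n') * c, (m + m') * b + (n + n') * d)"
        by (simp add: algebra_simps)
      then show ?thesis by blast
    qed
  qed auto
  moreover have "(a, b) \<in> ?R"
    by (rule CollectI, rule exI[of _ 1], rule exI[of _ 0]) simp
  moreover have "(c, d) \<in> ?R"
    by (rule CollectI, rule exI[of _ 0], rule exI[of _ 1]) simp
  ultimately show "generate ?G ?S \<subseteq> ?R"
    by (intro generate_subgroup_incl) auto
  have sub: "subgroup (generate ?G ?S) ?G"
    by (rule generate_is_subgroup) simp
  show "?R \<subseteq> generate ?G ?S"
  proof
    fix p assume "p \<in> ?R"
    then obtain m n where p: "p = (m * a + n * c, m * b + n * d)"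
      by blast
    have "(a, b) [^]\<^bsub>?G\<^esub> m \<otimes>\<^bsub>?G\<^esub> (c, d) [^]\<^bsub>?G\<^esub> n \<in> generate ?G ?S"
      by (intro subgroup.m_closed[OF sub] subgroup_int_pow_closed[OF sub] generate.incl insertI1 insertI2)
    then show "p \<in> generate ?G ?S"
      unfolding int_pow_add_ZxZ p by simp
  qed
qed

text \<open>
  If the generators are proportional, then so are any two elements \<open>u\<close>, \<open>v\<close> of the subgroup, which
  yields the relations \<open>fst v * u = fst u * v\<close> and \<open>snd v * u = snd u * v\<close>. Independence of \<open>u\<close> and
  \<open>v\<close> would make all these coefficients vanish, so that \<open>u = 0\<close>, which is absurd.
\<close>

lemma free_rank_2_imp_det_nonzero:
  assumes "has_free_rank ((add_monoid ZxZ)\<lparr>carrier := generate (add_monoid ZxZ) {(a, b), (c, d)}\<rparr>) 2"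
  shows "a * d - b * c \<noteq> 0"
proof
  assume det: "a * d - b * c = 0"
  define L where "L = generate (add_monoid ZxZ) {(a, b), (c, d)}"
  let ?G = "add_monoid ZxZ" and ?H = "(add_monoid ZxZ)\<lparr>carrier := L\<rparr>"
  interpret group ?G by (rule group_add_ZxZ)
  have sub: "subgroup L ?G"
    unfolding L_def by (rule generate_is_subgroup) simp
  obtain u v where "u \<in> carrier ?H" "v \<in> carrier ?H"
    and indep: "\<And>(m::int) (n::int). u [^]\<^bsub>?H\<^esub> m = v [^]\<^bsub>?H\<^esub> n \<Longrightarrow> m = 0 \<and> n = 0"
    using free_rank_2_independent_pair[OF subgroup_imp_group[OF sub] assms[folded L_def]] by blast
  then have uv: "u \<in> L" "v \<in> L"
    by simp_all
  obtain x y z w where xy: "u = (x, y)" and zw: "v = (z, w)"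
    by fastforce
  \<comment> \<open>Powers in the additive group are integer multiples, so independence reads coordinatewise.\<close>
  have rel: "m = 0 \<and> n = 0" if "m * x = n * z" "m * y = n * w" for m n :: int
  proof (rule indep)
    have "u [^]\<^bsub>?G\<^esub> m = v [^]\<^bsub>?G\<^esub> n"
      unfolding xy zw int_pow_add_ZxZ using that by simp
    then show "u [^]\<^bsub>?H\<^esub> m = v [^]\<^bsub>?H\<^esub> n"
      by (simp only: int_pow_consistent[OF sub uv(1)] int_pow_consistent[OF sub uv(2)])
  qed
  obtain i j k l where "x = i * a + j * c" "y = i * b + j * d" "z = k * a + l * c" "w = k * b + l * d"
    using uv unfolding L_def generate_pair_ZxZ xy zw by blast
  then have "x * w - y * z = (i * l - j * k) * (a * d - b * c)"
    by (simp add: algebra_simps)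
  with det have "x * w = y * z"
    by simp
  then have "x = 0 \<and> y = 0"
    using rel[of z x] rel[of w y] by (simp add: mult.commute)
  then show False
    using rel[of 1 0] by simp
qed

section \<open>Ideals of the product ring\<close>

text \<open>
  Since \<open>(r, s) * (x, y) = (r - s) * (x, 0) + s * (x, y)\<close>, closure under multiplication by the
  idempotent \<open>(1, 0)\<close> suffices.
\<close>

lemma ideal_ZxZ_iff:
  assumes sub: "subgroup L (add_monoid ZxZ)"
  shows "ideal L ZxZ \<longleftrightarrow> (\<forall>x y. (x, y) \<in> L \<longrightarrow> (x, 0) \<in> L)"
proof
  assume "ideal L ZxZ"
  then show "\<forall>x y. (x, y) \<in> L \<longrightarrow> (x, 0) \<in> L"
    using ideal.I_l_closed[of L ZxZ _ "(1, 0)"] by fastforce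
next
  assume proj: "\<forall>x y. (x, y) \<in> L \<longrightarrow> (x, 0) \<in> L"
  interpret group "add_monoid ZxZ" by (rule group_add_ZxZ)
  have closed: "(r * x, s * y) \<in> L" if L: "(x, y) \<in> L" for x y r s
  proof -
    have "(x, 0) [^]\<^bsub>add_monoid ZxZ\<^esub> (r - s) \<otimes>\<^bsub>add_monoid ZxZ\<^esub> (x, y) [^]\<^bsub>add_monoid ZxZ\<^esub> s \<in> L"
      using L proj by (intro subgroup.m_closed[OF sub] subgroup_int_pow_closed[OF sub]) auto
    then show ?thesis
      unfolding int_pow_add_ZxZ by (simp add: algebra_simps)
  qed
  show "ideal L ZxZ"
  proof (rule idealI[OF ring_ZxZ sub])
    fix p q assume "p \<in> L"
    then have "(fst q * fst p, snd q * snd p) \<in> L"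
      by (intro closed) simp
    then show "q \<otimes>\<^bsub>ZxZ\<^esub> p \<in> L" and "p \<otimes>\<^bsub>ZxZ\<^esub> q \<in> L"
      by (cases p; cases q; simp add: mult.commute)+
  qed
qed

text \<open>
  Cramer's rule: solving \<open>m * (a, b) + n * (c, d) = (x, 0)\<close> gives \<open>D * m = x * d\<close> and
  \<open>D * n = - x * b\<close>, where \<open>D\<close> is the determinant.
\<close>

lemma axis_vector_in_lattice_iff:
  fixes a b c d x :: int
  assumes det: "a * d - b * c \<noteq> 0"
  shows "(\<exists>m n. m * a + n * c = x \<and> m * b + n * d = 0) \<longleftrightarrow>
    a * d - b * c dvd x * b \<and> a * d - b * c dvd x * d"
proof
  assume "\<exists>m n. m * a + n * c = x \<and> m * b + n * d = 0"
  then obtain m n where eq: "x = m * a + n * c" "m * b + n * d = 0"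
    by blast
  have "x * b - (a * d - b * c) * - n = a * (m * b + n * d)"
    and "x * d - (a * d - b * c) * m = c * (m * b + n * d)"
    by (simp_all add: eq(1) algebra_simps)
  then have "x * b = (a * d - b * c) * - n" "x * d = (a * d - b * c) * m"
    by (simp_all add: eq(2))
  then show "a * d - b * c dvd x * b \<and> a * d - b * c dvd x * d"
    by (metis dvd_triv_left)
next
  assume "a * d - b * c dvd x * b \<and> a * d - b * c dvd x * d"
  then obtain m n where m: "x * d = (a * d - b * c) * m" and n: "x * b = (a * d - b * c) * n"
    by (metis dvdE)
  have "(a * d - b * c) * (m * a - n * c) = x * d * a - x * b * c"
    and "(a * d - b * c) * (m * b - n * d) = x * d * b - x * b * d"
    unfolding m n by (simp_all add: algebra_simps)
  then have "(a * d - b * c) * (m * a - n * c) = (a * d - b * c) * x"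
    and "(a * d - b * c) * (m * b - n * d) = 0"
    by (simp_all add: algebra_simps)
  then have "m * a + (- n) * c = x \<and> m * b + (- n) * d = 0"
    using det by simp
  then show "\<exists>m n. m * a + n * c = x \<and> m * b + n * d = 0"
    by blast
qed

theorem theorem3p8:
  fixes a b c d :: int and L :: "(int \<times> int) set"
  assumes gen: "L = generate (add_monoid ZxZ) {(a, b), (c, d)}"
    and rank: "has_free_rank ((add_monoid ZxZ)\<lparr>carrier := L\<rparr>) 2"
  shows "ideal L ZxZ \<longleftrightarrow> a * d - b * c dvd gcd a c * gcd b d"
proof -
  interpret group "add_monoid ZxZ" by (rule group_add_ZxZ)
  have sub: "subgroup L (add_monoid ZxZ)"
    unfolding gen by (rule generate_is_subgroup) simp
  have det: "a * d - b * c \<noteq> 0"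
    using free_rank_2_imp_det_nonzero rank unfolding gen .
  have in_L: "(x, 0) \<in> L \<longleftrightarrow> a * d - b * c dvd x * b \<and> a * d - b * c dvd x * d" for x
    unfolding axis_vector_in_lattice_iff[OF det, symmetric] gen generate_pair_ZxZ by auto
  have "(\<forall>x y. (x, y) \<in> L \<longrightarrow> (x, 0) \<in> L) \<longleftrightarrow> (a, 0) \<in> L \<and> (c, 0) \<in> L"
  proof
    assume "\<forall>x y. (x, y) \<in> L \<longrightarrow> (x, 0) \<in> L"
    then show "(a, 0) \<in> L \<and> (c, 0) \<in> L"
      using generate.incl[of _ "{(a, b), (c, d)}" "add_monoid ZxZ"] unfolding gen by blast
  next
    assume "(a, 0) \<in> L \<and> (c, 0) \<in> L"
    then have "(m * a + n * c, 0) \<in> L" for m n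
      unfolding in_L distrib_right mult.assoc by (blast intro: dvd_add dvd_mult)
    then show "\<forall>x y. (x, y) \<in> L \<longrightarrow> (x, 0) \<in> L"
      unfolding gen generate_pair_ZxZ by blast
  qed
  then show ?thesis
    unfolding ideal_ZxZ_iff[OF sub] dvd_gcd_mult_gcd_iff in_L by blast
qed

end
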